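(* Let $r\ge 2$, $n=2^r$, $M=2^{n-r}$, $\nu=2^{r-1}-1$. (1) If $\mathcal{C}^*$ is a zeroed ENP1CC of length $n+1$, then $A_i(\mathcal{C}^* )=0$ for odd $i$, $A_0(\mathcal{C}^* )=1$, and for even $i>0$, $$A_i(\mathcal{C}^* )=\frac{\binom{n+1}{i}+(n-1)(\Delta_{i-1}+\Delta_i)}{n}.$$ (2) If $\mathcal{C}^*$ is a non-zeroed ENP1CC of length $n+1$ with exactly one codeword of weight one, then $A_i(\mathcal{C}^* )=0$ for even $i$, $A_1(\mathcal{C}^* )=1$, and for odd $i>1$, $$A_i(\mathcal{C}^* )=\frac{\binom{n+1}{i}-(\Delta_{i-1}+\Delta_{i-2})}{n}.$$ (3) If $\mathcal{C}^*$ is a non-zeroed ENP1CC of length $n+1$ with exactly two codewords of weight one, then $A_i(\mathcal{C}^* )=0$ for even $i$, $A_1(\mathcal{C}^* )=2$, and for odd $i>1$, $$A_i(\mathcal{C}^* )=\frac{\binom{n+1}{i}+(n-1)(\Delta_{i-1}+\Delta_{i-2})}{n}.$$ (4) If $\mathcal{C}^*$ is a non-zeroed ENP1CC of length $n+1$ whose codewords have even weight, then $A_i(\mathcal{C}^* )=0$ for odd $i$, $A_0(\mathcal{C}^* )=0$, and for even $i>0$, $$A_i(\mathcal{C}^* )=\frac{\binom{n+1}{i}-(\Delta_i+\Delta_{i-1})}{n}.$$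
   Context: All codes are binary; $A_i(\mathcal{C})$ is the number of codewords of $\mathcal{C}$ of Hamming weight $i$. A code is zeroed if it contains the all-zero word, non-zeroed otherwise. An NP1CC of length $n=2^r$ is a code $\mathcal{C}\subseteq\mathbb{F}_2^n$ with $|\mathcal{C}|=2^{n-r}$ such that every word of $\mathbb{F}_2^n$ is at distance at most $1$ from some codeword. An ENP1CC is a code of length $n+1$ of the form $\{(\mathbf{c},p(\mathbf{c})):\mathbf{c}\in\mathcal{C}\}$ or $\{(\mathbf{c},1+p(\mathbf{c})):\mathbf{c}\in\mathcal{C}\}$ for an NP1CC $\mathcal{C}$, where $p(\mathbf{c})=\sum_i c_i\bmod 2$. For integers $i\ge 0$: $\Delta_i=\binom{\nu}{\lfloor i/2\rfloor}$ if $i\equiv 0,3\pmod 4$ and $\Delta_i=-\binom{\nu}{\lfloor i/2\rfloor}$ if $i\equiv 1,2\pmod 4$ (with $\binom{a}{b}=0$ for $b>a$). *)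

theory Defs
  imports Complex_Main "HOL-Library.Z2"
begin

type_synonym word = "bit list"

definition words :: "nat \<Rightarrow> word set" where
  "words n = {x. length x = n}"

(* Intended for words of equal length only. *)
definition hamming_dist :: "word \<Rightarrow> word \<Rightarrow> nat" where
  "hamming_dist x y = card {i. i < length x \<and> x ! i \<noteq> y ! i}"

definition weight :: "word \<Rightarrow> nat" where
  "weight x = card {i. i < length x \<and> x ! i \<noteq> 0}"

definition weight_count :: "word set \<Rightarrow> nat \<Rightarrow> nat" where
  "weight_count C i = card {c \<in> C. weight c = i}"

definition zeroed :: "nat \<Rightarrow> word set \<Rightarrow> bool" where
  "zeroed m C \<longleftrightarrow> replicate m 0 \<in> C"

(* Nearly perfect 1-covering codes (NP1CC) of length 2^r. *)
definition np1cc :: "nat \<Rightarrow> word set \<Rightarrow> bool" where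
  "np1cc r C \<longleftrightarrow>
     C \<subseteq> words (2 ^ r) \<and>
     card C = 2 ^ (2 ^ r - r) \<and>
     (\<forall>x \<in> words (2 ^ r). \<exists>c \<in> C. hamming_dist x c \<le> 1)"

(* The sum is taken in the two-element field, i.e. modulo 2. *)
definition parity_bit :: "word \<Rightarrow> bit" where
  "parity_bit c = sum_list c"

(* Extended NP1CCs; their length is 2^r + 1. *)
definition enp1cc :: "nat \<Rightarrow> word set \<Rightarrow> bool" where
  "enp1cc r D \<longleftrightarrow>
     (\<exists>C. np1cc r C \<and>
        (D = {c @ [parity_bit c] | c. c \<in> C} \<or>
         D = {c @ [1 + parity_bit c] | c. c \<in> C}))"

definition Delta :: "nat \<Rightarrow> nat \<Rightarrow> int" where
  "Delta \<nu> i =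
     (if i mod 4 = 0 \<or> i mod 4 = 3 then int (\<nu> choose (i div 2))
      else - int (\<nu> choose (i div 2)))"

end

theory Submission
  imports Defs
begin

text \<open>
  Let \<open>N = n + 1\<close> and let \<open>D\<close> be the extended code, whose words all have the same parity. For a word
  \<open>w\<close> of the other parity let \<open>e w\<close> be the number of its neighbours in \<open>D\<close> minus one, and let \<open>E x\<close> be
  the sum of \<open>e\<close> over the neighbours of \<open>x\<close>. As \<open>N\<close> is odd, \<open>E x\<close> is odd (so at least 1) for \<open>x\<close> of the
  parity of \<open>D\<close> outside \<open>D\<close>, while the sum of \<open>E\<close> over \<open>D\<close> is the sum of \<open>(e + 1) e \<ge> 2 e\<close>.
  Since \<open>|D| n = 2 ^ n\<close>, both bounds are attained, and it follows that adjoining \<open>Z = {w. e w = 1}\<close> gives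
  a set \<open>S = D \<union> Z\<close> for which every word \<open>w\<close> has exactly \<open>1 + [w \<in> S]\<close> neighbours in \<open>S\<close>. Counting
  neighbours weight by weight, the weight distribution \<open>F\<close> of \<open>S\<close> satisfies
  \<open>(j + 1) F (j + 1) + (N - j + 1) F (j - 1) = (N choose j) + F j\<close>, so it is determined
  by \<open>F 0 \<in> {0, 1}\<close>, and it agrees with that of \<open>D\<close> on the indices of the parity of \<open>D\<close>.
\<close>

section \<open>Bit flips, Hamming weight and the number of words\<close>

definition flip :: "nat \<Rightarrow> word \<Rightarrow> word" where
  "flip i w = w[i := w ! i + 1]"

text \<open>The adjacency operator of the hypercube, acting on integer-valued functions.\<close>

definition nbr_sum :: "(word \<Rightarrow> int) \<Rightarrow> word \<Rightarrow> int" where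
  "nbr_sum f w = (\<Sum>i<length w. f (flip i w))"

lemma length_flip [simp]: "length (flip i w) = length w"
  by (simp add: flip_def)

lemma flip_in_words_iff [simp]: "flip i w \<in> words N \<longleftrightarrow> w \<in> words N"
  by (simp add: words_def)

lemma flip_flip [simp]: "flip i (flip i w) = w"
proof (cases "i < length w")
  case True
  have "w ! i + 1 + 1 = w ! i" by (cases "w ! i") simp_all
  with True show ?thesis by (simp add: flip_def del: add_bit_eq_xor)
qed (simp add: flip_def list_update_beyond)

lemma flip_commute: "flip i (flip j w) = flip j (flip i w)"
  by (cases "i = j") (simp_all add: flip_def list_update_swap)

lemma weight_eq_length_filter: "weight w = length (filter (\<lambda>b. b \<noteq> 0) w)"
  by (simp add: weight_def length_filter_conv_card)

lemma weight_simps [simp]: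
  "weight [] = 0" "weight (b # w) = of_bool (b \<noteq> 0) + weight w"
  "weight (v @ w) = weight v + weight w"
  by (simp_all add: weight_eq_length_filter)

text \<open>Splitting \<open>w\<close> around position \<open>i\<close> isolates the one bit that
  changes. The second claim makes the truncated subtraction in the first one exact.\<close>

lemma weight_flip:
  assumes "i < length w"
  shows "weight (flip i w) = (if w ! i = 0 then Suc (weight w) else weight w - 1)"
    and "w ! i \<noteq> 0 \<Longrightarrow> weight w > 0"
proof -
  have w: "w = take i w @ w ! i # drop (Suc i) w"
    using assms by (simp add: id_take_nth_drop)
  have f: "flip i w = take i w @ (w ! i + 1) # drop (Suc i) w"
    using assms by (simp add: flip_def upd_conv_take_nth_drop)
  have 1: "weight w = weight (take i w) + of_bool (w ! i \<noteq> 0) + weight (drop (Suc i) w)"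
    by (subst w) simp
  have 2: "weight (flip i w) = weight (take i w) + of_bool (w ! i = 0) + weight (drop (Suc i) w)"
    by (cases "w ! i") (simp_all add: f)
  show "weight (flip i w) = (if w ! i = 0 then Suc (weight w) else weight w - 1)"
    using 1 2 by simp
  show "weight w > 0" if "w ! i \<noteq> 0"
    using 1 that by simp
qed

lemma even_weight_flip: "i < length w \<Longrightarrow> even (weight (flip i w)) \<longleftrightarrow> odd (weight w)"
  using weight_flip[of i w] by auto

lemma sum_list_eq_odd_weight: "sum_list w = (of_bool (odd (weight w)) :: bit)"
proof (induction w)
  case (Cons b w)
  then show ?case by (cases b) auto
qed simp

lemma weight_eq_0_iff: "weight w = 0 \<longleftrightarrow> w = replicate (length w) 0"
  by (induction w) auto

lemma finite_words [simp]: "finite (words N)"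
  and card_words: "card (words N) = 2 ^ N"
proof -
  have eq: "words N = {w. set w \<subseteq> (UNIV :: bit set) \<and> length w = N}"
    by (simp add: words_def)
  have UNIV_bit: "(UNIV :: bit set) = {0, 1}" by (auto intro: bit.exhaust)
  have fin: "finite (UNIV :: bit set)" "card (UNIV :: bit set) = 2"
    unfolding UNIV_bit by simp_all
  show "finite (words N)" 
    unfolding eq by (rule finite_lists_length_eq) (fact fin)
  show "card (words N) = 2 ^ N"
    unfolding eq using card_lists_length_eq[OF fin(1), of N] fin(2) by simp
qed

lemma card_words_weight: "card {w \<in> words N. weight w = j} = N choose j"
proof -
  have "bij_betw (\<lambda>w. {i. i < N \<and> w ! i \<noteq> 0}) {w \<in> words N. weight w = j}
      {A. A \<subseteq> {..<N} \<and> card A = j}"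
  proof (rule bij_betw_byWitness[where f' = "\<lambda>A. map (\<lambda>i. of_bool (i \<in> A)) [0..<N]"])
    show "\<forall>w\<in>{w \<in> words N. weight w = j}.
        map (\<lambda>i. of_bool (i \<in> {i. i < N \<and> w ! i \<noteq> 0})) [0..<N] = w"
      by (auto simp: words_def intro!: nth_equalityI)
  qed (auto simp: words_def weight_def cong: conj_cong intro!: arg_cong[where f = card])
  then show ?thesis
    using n_subsets[of "{..<N}" j] by (simp add: bij_betw_same_card)
qed

section \<open>Neighbour sums on the hypercube\<close>

lemma sum_words_flip: "(\<Sum>w\<in>words N. f (flip i w)) = (\<Sum>w\<in>words N. f w)"
  by (rule sum.reindex_bij_witness[where i = "flip i" and j = "flip i"]) auto

text \<open>Each \<open>flip i\<close> is an involution of the cube, so reindexing moves it from one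
  factor to the other: the adjacency operator is self-adjoint. All double counting of adjacent pairs
  rests on this.\<close>

lemma nbr_sum_adjoint:
  "(\<Sum>w\<in>words N. nbr_sum f w * h w) = (\<Sum>w\<in>words N. f w * nbr_sum h w)"
proof -
  have "(\<Sum>w\<in>words N. nbr_sum f w * h w) = (\<Sum>w\<in>words N. \<Sum>i<N. f (flip i w) * h w)"
    by (simp add: nbr_sum_def words_def sum_distrib_right)
  also have "\<dots> = (\<Sum>i<N. \<Sum>w\<in>words N. f (flip i w) * h w)"
    by (rule sum.swap)
  also have "\<dots> = (\<Sum>i<N. \<Sum>w\<in>words N. f w * h (flip i w))"
  proof (rule sum.cong[OF refl])
    fix i
    show "(\<Sum>w\<in>words N. f (flip i w) * h w) = (\<Sum>w\<in>words N. f w * h (flip i w))"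
      using sum_words_flip[of "\<lambda>w. f w * h (flip i w)" i N] by simp
  qed
  also have "\<dots> = (\<Sum>w\<in>words N. \<Sum>i<N. f w * h (flip i w))"
    by (rule sum.swap)
  also have "\<dots> = (\<Sum>w\<in>words N. f w * nbr_sum h w)"
    by (simp add: nbr_sum_def words_def sum_distrib_left)
  finally show ?thesis .
qed

lemma sum_nbr_sum: "(\<Sum>w\<in>words N. nbr_sum f w) = int N * (\<Sum>w\<in>words N. f w)"
  using nbr_sum_adjoint[of f "\<lambda>_. 1" N]
  by (simp add: nbr_sum_def words_def sum_distrib_left mult.commute)

lemma even_symmetric_sum_minus_diagonal:
  fixes a :: "nat \<Rightarrow> nat \<Rightarrow> int"
  assumes "\<And>i j. a i j = a j i"
  shows "even ((\<Sum>i<N. \<Sum>j<N. a i j) - (\<Sum>i<N. a i i))"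
proof (induction N)
  case (Suc N)
  have "(\<Sum>i<N. a N i) = (\<Sum>i<N. a i N)"
    by (intro sum.cong refl assms)
  with Suc show ?case
    by (simp add: sum.distrib)
qed simp

text \<open>Flips commute, so the two-step walks with \<open>i \<noteq> j\<close> pair off modulo 2,
  while the \<open>length w\<close> walks with \<open>i = j\<close> return to
  \<open>w\<close>.\<close>

lemma even_nbr_sum_nbr_sum_minus:
  "even (nbr_sum (nbr_sum f) w - int (length w) * f w)"
  using even_symmetric_sum_minus_diagonal[of "\<lambda>i j. f (flip j (flip i w))" "length w"]
  by (simp add: nbr_sum_def flip_commute)

lemma nbr_sum_indicator:
  "nbr_sum (\<lambda>v. of_bool (v \<in> A)) w = int (card {i. i < length w \<and> flip i w \<in> A})"
proof -
  have "{i. i < length w \<and> flip i w \<in> A} = {i \<in> {..<length w}. flip i w \<in> A}" by auto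
  then show ?thesis by (simp add: nbr_sum_def sum.If_cases of_bool_def Int_def)
qed

section \<open>Completing a covering of one parity class\<close>

lemma card_parity_class:
  assumes "N > 0"
  shows "card {w \<in> words N. odd (weight w) = b} = 2 ^ (N - 1)"
proof -
  have "bij_betw (flip 0) {w \<in> words N. odd (weight w) = b} {w \<in> words N. odd (weight w) \<noteq> b}"
    using assms
    by (intro bij_betw_byWitness[where f' = "flip 0"]) (auto simp: words_def even_weight_flip)
  then have eq: "card {w \<in> words N. odd (weight w) = b} = card {w \<in> words N. odd (weight w) \<noteq> b}"
    by (rule bij_betw_same_card)
  have "words N = {w \<in> words N. odd (weight w) = b} \<union> {w \<in> words N. odd (weight w) \<noteq> b}"
    by auto
  then have "2 ^ N = card {w \<in> words N. odd (weight w) = b} + card {w \<in> words N. odd (weight w) \<noteq> b}"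
    using card_Un_disjoint[of "{w \<in> words N. odd (weight w) = b}" "{w \<in> words N. odd (weight w) \<noteq> b}"]
    by (auto simp: card_words)
  moreover have "(2::nat) ^ N = 2 * 2 ^ (N - 1)"
    using assms by (simp flip: power_Suc)
  ultimately show ?thesis using eq by linarith
qed

text \<open>The opposite parity of \<open>Z\<close> lets \<open>D\<close> be read off from
  \<open>D \<union> Z\<close> by the parity of the weight, so that counts for the union transfer to
  \<open>D\<close>.\<close>

lemma covering_completion:
  assumes D: "D \<subseteq> words N" "\<And>d. d \<in> D \<Longrightarrow> odd (weight d) = b"
    and N: "odd N" and card: "card D * (N - 1) = 2 ^ (N - 1)"
    and cover: "\<And>w. w \<in> words N \<Longrightarrow> odd (weight w) \<noteq> b \<Longrightarrow> \<exists>i<N. flip i w \<in> D"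
  obtains Z where "Z \<subseteq> words N" "\<And>z. z \<in> Z \<Longrightarrow> odd (weight z) \<noteq> b"
    "\<And>w. w \<in> words N \<Longrightarrow>
       nbr_sum (\<lambda>v. of_bool (v \<in> D \<union> Z)) w = 1 + of_bool (w \<in> D \<union> Z)"
proof -
  define P where "P = {w \<in> words N. odd (weight w) = b}"
  define Q where "Q = {w \<in> words N. odd (weight w) \<noteq> b}"
  define M where "M = int (card D)"
  have fin [simp]: "finite P" "finite Q" "finite D"
    using D(1) finite_subset[OF _ finite_words] by (auto simp: P_def Q_def)
  have PQ: "words N = P \<union> Q" "P \<inter> Q = {}" and DP: "D \<subseteq> P"
    using D by (auto simp: P_def Q_def)
  have Npos: "N > 0" using N by (cases N) auto
  \<comment> \<open>The hypothesis \<open>card\<close> turns the size \<open>2 ^ (N - 1)\<close> of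
    each parity class into a multiple of \<open>M\<close>, the unit in which the sums below are
    compared.\<close>
  have cardP: "int (card P) = (int N - 1) * M" and cardQ: "int (card Q) = (int N - 1) * M"
  proof -
    have *: "(2::int) ^ (N - 1) = (int N - 1) * M"
      using arg_cong[OF card, of int] Npos by (simp add: M_def of_nat_diff mult.commute)
    show "int (card P) = (int N - 1) * M"
      unfolding P_def card_parity_class[OF Npos] using * by simp
    show "int (card Q) = (int N - 1) * M"
      using card_parity_class[OF Npos, of "\<not> b"] * by (simp add: Q_def)
  qed
  have flipPQ: "flip i x \<in> Q" if "x \<in> P" "i < N" for i x
    using that by (auto simp: P_def Q_def words_def even_weight_flip)
  have flipQP: "flip i x \<in> P" if "x \<in> Q" "i < N" for i x
    using that by (auto simp: P_def Q_def words_def even_weight_flip)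
  have len: "length x = N" if "x \<in> P \<or> x \<in> Q" for x
    using that by (auto simp: P_def Q_def words_def)
  define \<chi> where "\<chi> = (\<lambda>w. of_bool (w \<in> D) :: int)"
  define g where "g = nbr_sum \<chi>"
  \<comment> \<open>The value 0 off \<open>Q\<close> confines \<open>e\<close>, and later
    \<open>Z\<close>, to the parity opposite to that of \<open>D\<close>.\<close>
  define e where "e = (\<lambda>w. if w \<in> Q then g w - 1 else 0)"
  define E where "E = nbr_sum e"
  have g_card: "g w = int (card {i. i < length w \<and> flip i w \<in> D})" for w
    by (simp add: g_def \<chi>_def nbr_sum_indicator)
  have gP: "g w = 0" if "w \<in> P" for w
    using flipPQ[OF that] DP PQ(2) len that by (auto simp: g_card)
  have gQ: "g w \<ge> 1" if "w \<in> Q" for w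
  proof -
    have "{i. i < length w \<and> flip i w \<in> D} \<noteq> {}"
      using cover[of w] that by (auto simp: Q_def words_def)
    then have "card {i. i < length w \<and> flip i w \<in> D} > 0"
      by (simp add: card_gt_0_iff)
    then show ?thesis by (simp add: g_card)
  qed
  have eQ: "e w \<ge> 0" for w using gQ[of w] by (cases "w \<in> Q") (simp_all add: e_def)
  have eP: "e w = 0" if "w \<in> P" for w
    using that PQ(2) by (auto simp: e_def)
  have EQ0: "E w = 0" if "w \<in> Q" for w
    using flipQP[OF that] len that by (auto simp: E_def nbr_sum_def eP intro!: sum.neutral)
  have EP: "E x = nbr_sum g x - int N" if "x \<in> P" for x
    using flipPQ[OF that] len that by (simp add: E_def nbr_sum_def e_def sum_subtractf)
  have Enn: "E x \<ge> 0" for x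
    unfolding E_def nbr_sum_def by (intro sum_nonneg eQ)
  \<comment> \<open>Two adjacency steps applied to \<open>\<chi>\<close> give
    \<open>N * \<chi>\<close> modulo 2. Subtracting the odd number \<open>N\<close> leaves an even
    value exactly where \<open>\<chi>\<close> is 1.\<close>
  have E_even: "even (E x) \<longleftrightarrow> x \<in> D" if "x \<in> P" for x
  proof -
    have "even (nbr_sum g x - int N * \<chi> x)"
      using even_nbr_sum_nbr_sum_minus[of \<chi> x] that by (simp add: g_def len)
    with N show ?thesis by (simp add: EP[OF that] \<chi>_def)
  qed
  have sum_words: "(\<Sum>w\<in>words N. f w) = (\<Sum>w\<in>P. f w) + (\<Sum>w\<in>Q. f w)" for f :: "word \<Rightarrow> int"
    unfolding PQ(1) by (rule sum.union_disjoint) (use PQ(2) in auto)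
  have sum\<chi>: "(\<Sum>w\<in>words N. \<chi> w * f w) = (\<Sum>w\<in>D. f w)" for f
    using D(1) by (intro sum.mono_neutral_cong_right) (auto simp: \<chi>_def)
  \<comment> \<open>Each word of \<open>D\<close> has \<open>N\<close> neighbours, all in
    \<open>Q\<close>. Removing 1 for every word of \<open>Q\<close> leaves
    \<open>N * M - (N - 1) * M = M\<close>.\<close>
  have "(\<Sum>w\<in>words N. g w) = int N * M"
    using sum\<chi>[of "\<lambda>_. 1"] by (simp add: g_def sum_nbr_sum M_def)
  then have "(\<Sum>w\<in>Q. g w) = int N * M"
    by (simp add: sum_words gP)
  then have sum_e: "(\<Sum>w\<in>Q. e w) = M"
    by (simp add: e_def sum_subtractf cardQ algebra_simps)
  have "(\<Sum>w\<in>words N. E w) = int N * (\<Sum>w\<in>words N. e w)"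
    by (simp add: E_def sum_nbr_sum)
  moreover have "(\<Sum>w\<in>P. e w) = 0"
    by (simp add: eP)
  ultimately have "(\<Sum>w\<in>P. E w) = int N * M"
    using sum_e by (simp add: sum_words EQ0)
  moreover have "(\<Sum>w\<in>P. E w) = (\<Sum>w\<in>P - D. E w) + (\<Sum>w\<in>D. E w)"
    by (rule sum.subset_diff) (use DP in auto)
  \<comment> \<open>Self-adjointness turns the sum into one of \<open>g * e\<close>, which on
    \<open>Q\<close> is \<open>(e + 1) * e = e * (e - 1) + 2 * e\<close>.\<close>
  moreover have "(\<Sum>w\<in>D. E w) = (\<Sum>w\<in>Q. e w * (e w - 1)) + 2 * M"
  proof -
    have "(\<Sum>w\<in>D. E w) = (\<Sum>w\<in>words N. g w * e w)"
      unfolding g_def nbr_sum_adjoint by (simp add: sum\<chi> E_def)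
    also have "\<dots> = (\<Sum>w\<in>Q. e w * (e w - 1) + 2 * e w)"
      by (auto simp: sum_words gP e_def algebra_simps intro!: sum.cong)
    also have "\<dots> = (\<Sum>w\<in>Q. e w * (e w - 1)) + 2 * M"
      by (simp add: sum.distrib sum_e flip: sum_distrib_left)
    finally show ?thesis .
  qed
  moreover have "(\<Sum>w\<in>P - D. E w) = (\<Sum>w\<in>P - D. E w - 1) + (int N - 2) * M"
  proof -
    have "int (card (P - D)) = int (card P) - M"
      using card_mono[OF fin(1) DP] by (simp add: card_Diff_subset DP of_nat_diff M_def)
    then show ?thesis by (simp add: sum_subtractf cardP algebra_simps)
  qed
  \<comment> \<open>The total \<open>N * M\<close> of \<open>E\<close> over \<open>P\<close> is
    already used up by \<open>2 * M\<close> on \<open>D\<close> and \<open>(N - 2) * M\<close> on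
    \<open>P - D\<close>, so the two excess sums cancel.\<close>
  ultimately have slack: "(\<Sum>w\<in>Q. e w * (e w - 1)) + (\<Sum>w\<in>P - D. E w - 1) = 0"
    and sumD: "(\<Sum>w\<in>D. E w) = (\<Sum>w\<in>Q. e w * (e w - 1)) + 2 * M"
    by (simp_all add: algebra_simps)
  have nn: "e w * (e w - 1) \<ge> 0" for w
    using eQ[of w] by (cases "e w = 0") auto
  have nn': "E w - 1 \<ge> 0" if "w \<in> P - D" for w
    using E_even[of w] Enn[of w] that by (cases "E w = 0") auto
  have nns: "(\<Sum>w\<in>Q. e w * (e w - 1)) \<ge> 0" "(\<Sum>w\<in>P - D. E w - 1) \<ge> 0"
    using nn nn' by (auto intro!: sum_nonneg)
  have z: "(\<Sum>w\<in>Q. e w * (e w - 1)) = 0" "(\<Sum>w\<in>P - D. E w - 1) = 0"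
    using slack nns by linarith+
  have e01: "e w = 0 \<or> e w = 1" for w
  proof (cases "w \<in> Q")
    case True
    then have "e w * (e w - 1) = 0"
      using sum_nonneg_eq_0_iff[of Q "\<lambda>w. e w * (e w - 1)"] z(1) nn by simp
    then show ?thesis by simp
  qed (simp add: e_def)
  have E1: "E w = 1" if "w \<in> P - D" for w
    using sum_nonneg_eq_0_iff[of "P - D" "\<lambda>w. E w - 1"] z(2) nn' that by auto
  define Z where "Z = {w. e w = 1}"
  have ZQ: "Z \<subseteq> Q" by (auto simp: Z_def e_def split: if_splits)
  have e_Z: "e = (\<lambda>w. of_bool (w \<in> Z))"
    using e01 by (auto simp: Z_def fun_eq_iff)
  have E_card: "E w = int (card {i. i < length w \<and> flip i w \<in> Z})" for w
    by (simp add: E_def e_Z nbr_sum_indicator)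
  \<comment> \<open>Distinct flips give two neighbours in \<open>Z\<close>, hence
    \<open>E v \<ge> 2\<close>, whereas \<open>E\<close> is 1 on \<open>P - D\<close>.\<close>
  have inD: "v \<in> D" if "v \<in> P" "flip i v \<in> Z" "flip j v \<in> Z" "i \<noteq> j" "i < N" "j < N" for v i j
  proof (rule ccontr)
    assume "v \<notin> D"
    then have "E v = 1" using E1 that by auto
    moreover have "card {i, j} \<le> card {i. i < length v \<and> flip i v \<in> Z}"
      using that len by (intro card_mono) auto
    ultimately show False using that by (simp add: E_card)
  qed
  \<comment> \<open>Among three \<open>Z\<close>-neighbours of \<open>x\<close>, two have a second common neighbour, which then lies in \<open>D\<close>;
    so one of the three would have at least three neighbours in \<open>D\<close>.\<close>
  have E_le: "E x \<le> 2" if "x \<in> D" for x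
  proof (rule ccontr)
    assume "\<not> E x \<le> 2"
    then have "3 \<le> card {i. i < length x \<and> flip i x \<in> Z}"
      by (simp add: E_card)
    then obtain I where I: "I \<subseteq> {i. i < length x \<and> flip i x \<in> Z}" "card I = 3"
      by (meson obtain_subset_with_card_n)
    then obtain i j k where ijk: "I = {i, j, k}" "i \<noteq> j" "j \<noteq> k" "i \<noteq> k"
      by (auto simp: card_3_iff)
    have xP: "x \<in> P" and xN: "length x = N" using DP that len by auto
    have lt: "i < N" "j < N" "k < N" and zs: "flip i x \<in> Z" "flip j x \<in> Z" "flip k x \<in> Z"
      using I ijk xN by auto
    have P2: "flip l (flip i x) \<in> P" if "l < N" for l
      using flipPQ flipQP lt that xP by blast
    have D2: "flip l (flip i x) \<in> D" if "l < N" "l \<noteq> i" "flip l x \<in> Z" for l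
    proof (rule inD[where i = i and j = l])
      show "flip i (flip l (flip i x)) \<in> Z"
        using that by (simp add: flip_commute[of i l])
    qed (use that lt zs P2 in auto)
    have "card {i, j, k} \<le> card {l. l < length (flip i x) \<and> flip l (flip i x) \<in> D}"
      using lt xN zs ijk D2[of j] D2[of k] that by (intro card_mono) auto
    then have "g (flip i x) \<ge> 3"
      using ijk by (simp add: g_card)
    moreover have "flip i x \<in> Q" using flipPQ xP lt by auto
    ultimately show False using e01[of "flip i x"] by (auto simp: e_def)
  qed
  \<comment> \<open>The values of \<open>E\<close> on \<open>D\<close> average 2, so the upper bound
    \<open>E_le\<close> must be attained everywhere on \<open>D\<close>.\<close>
  have "(\<Sum>w\<in>D. 2 - E w) = 0"
    using sumD z by (simp add: sum_subtractf M_def)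
  then have E2: "E w = 2" if "w \<in> D" for w
    using sum_nonneg_eq_0_iff[of D "\<lambda>w. 2 - E w"] E_le that by auto
  show thesis
  proof
    show "Z \<subseteq> words N"
      using ZQ by (auto simp: Q_def)
    show "odd (weight z) \<noteq> b" if "z \<in> Z" for z
      using ZQ that by (auto simp: Q_def)
    fix w assume "w \<in> words N"
    then consider "w \<in> P" | "w \<in> Q" using PQ by auto
    then show "nbr_sum (\<lambda>v. of_bool (v \<in> D \<union> Z)) w = 1 + of_bool (w \<in> D \<union> Z)"
    proof cases
      \<comment> \<open>Neighbours of a word in \<open>P\<close> lie in \<open>Q\<close>, so only
        \<open>Z\<close> counts, and \<open>E\<close> is 2 on \<open>D\<close> and 1 on
        \<open>P - D\<close>.\<close>
      case 1
      then have "nbr_sum (\<lambda>v. of_bool (v \<in> D \<union> Z)) w = E w"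
        using flipPQ DP PQ(2) len unfolding E_def nbr_sum_def e_Z
        by (intro sum.cong) auto
      then show ?thesis using 1 E1 E2 ZQ PQ(2) by auto
    next
      \<comment> \<open>Here only \<open>D\<close> counts, and \<open>g w = 1 + e w\<close>, where
        \<open>e\<close> is the indicator of \<open>Z\<close>.\<close>
      case 2
      then have "nbr_sum (\<lambda>v. of_bool (v \<in> D \<union> Z)) w = g w"
        using flipQP ZQ PQ(2) len unfolding g_def nbr_sum_def \<chi>_def
        by (intro sum.cong) auto
      moreover have "w \<notin> D" using 2 DP PQ(2) by auto
      moreover have "g w = 1 + e w" using 2 by (simp add: e_def)
      ultimately show ?thesis by (simp add: e_Z)
    qed
  qed
qed

section \<open>A recurrence for the weight distribution\<close>

lemma int_weight_count:
  assumes "S \<subseteq> words N"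
  shows "int (weight_count S j) = (\<Sum>w\<in>words N. of_bool (w \<in> S) * of_bool (weight w = j))"
proof -
  have "(\<Sum>w\<in>words N. of_bool (w \<in> S) * of_bool (weight w = j)) =
      (\<Sum>w\<in>{c \<in> S. weight c = j}. 1 :: int)"
    using assms by (intro sum.mono_neutral_cong_right) auto
  then show ?thesis by (simp add: weight_count_def)
qed

text \<open>A flip at a one lowers the weight and a flip at a zero raises it, so
  \<open>weight w\<close> neighbours lie one level below and \<open>length w - weight w\<close> one
  level above.\<close>

lemma nbr_sum_weight:
  "nbr_sum (\<lambda>v. of_bool (weight v = j)) w =
     of_bool (weight w = Suc j) * int (weight w) +
     of_bool (Suc (weight w) = j) * (int (length w) - int (weight w))"
proof -
  have ones: "(\<Sum>i<length w. of_bool (w ! i \<noteq> 0)) = int (weight w)"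
  proof -
    have "{i. i < length w \<and> w ! i \<noteq> 0} = {i \<in> {..<length w}. w ! i \<noteq> 0}" by auto
    then show ?thesis by (simp add: weight_def sum.If_cases of_bool_def Int_def)
  qed
  have "of_bool (weight (flip i w) = j) =
      of_bool (weight w = Suc j) * of_bool (w ! i \<noteq> 0) +
      of_bool (Suc (weight w) = j) * (1 - of_bool (w ! i \<noteq> 0) :: int)"
    if "i < length w" for i
    using weight_flip[OF that] by auto
  then have "nbr_sum (\<lambda>v. of_bool (weight v = j)) w =
      (\<Sum>i<length w. of_bool (weight w = Suc j) * of_bool (w ! i \<noteq> 0) +
      of_bool (Suc (weight w) = j) * (1 - of_bool (w ! i \<noteq> 0) :: int))"
    unfolding nbr_sum_def by (intro sum.cong) auto
  also have "\<dots> = of_bool (weight w = Suc j) * int (weight w) +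
     of_bool (Suc (weight w) = j) * (int (length w) - int (weight w))"
    by (simp only: sum.distrib sum_subtractf ones flip: sum_distrib_left) simp
  finally show ?thesis .
qed

text \<open>Adjacent pairs of a word of weight \<open>j\<close> and a word of \<open>S\<close> are
  counted in two ways, with \<open>j = 0\<close> for the first equation and \<open>j = k + 1\<close>
  for the second.\<close>

lemma weight_count_recurrence:
  assumes S: "S \<subseteq> words N"
    and nbrs: "\<And>w. w \<in> words N \<Longrightarrow> nbr_sum (\<lambda>v. of_bool (v \<in> S)) w = 1 + of_bool (w \<in> S)"
  shows "weight_count S 1 = 1 + weight_count S 0"
    and "(int k + 2) * weight_count S (k + 2) + (int N - k) * weight_count S k =
      int (N choose (k + 1)) + weight_count S (k + 1)"
proof -
  \<comment> \<open>The words of \<open>S\<close> one level below stay an explicit sum over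
    \<open>Suc (weight w) = j\<close>, which is empty at \<open>j = 0\<close>.\<close>
  have *: "int (N choose j) + weight_count S j =
      int (Suc j) * weight_count S (Suc j) +
      (\<Sum>w\<in>words N. of_bool (w \<in> S) * of_bool (Suc (weight w) = j) * (int N - int (weight w)))"
    for j
  proof -
    have "int (N choose j) = (\<Sum>w\<in>words N. of_bool (weight w = j))"
      using int_weight_count[of "words N" N j] by (simp add: weight_count_def card_words_weight)
    then have "int (N choose j) + weight_count S j =
        (\<Sum>w\<in>words N. nbr_sum (\<lambda>v. of_bool (v \<in> S)) w * of_bool (weight w = j))"
      by (simp add: int_weight_count[OF S] nbrs distrib_right sum.distrib)
    also have "\<dots> = (\<Sum>w\<in>words N. of_bool (w \<in> S) * nbr_sum (\<lambda>v. of_bool (weight v = j)) w)"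
      by (rule nbr_sum_adjoint)
    also have "\<dots> = (\<Sum>w\<in>words N. int (Suc j) * (of_bool (w \<in> S) * of_bool (weight w = Suc j)) +
        of_bool (w \<in> S) * of_bool (Suc (weight w) = j) * (int N - int (weight w)))"
      by (intro sum.cong refl) (auto simp: nbr_sum_weight words_def)
    finally show ?thesis
      by (simp only: sum.distrib int_weight_count[OF S] flip: sum_distrib_left)
  qed
  show "weight_count S 1 = 1 + weight_count S 0"
    using *[of 0] by simp
  have "(\<Sum>w\<in>words N. of_bool (w \<in> S) * of_bool (Suc (weight w) = k + 1) * (int N - int (weight w)))
      = (int N - k) * weight_count S k"
    unfolding int_weight_count[OF S] sum_distrib_left
    by (intro sum.cong refl) auto
  then show "(int k + 2) * weight_count S (k + 2) + (int N - k) * weight_count S k =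
      int (N choose (k + 1)) + weight_count S (k + 1)"
    using *[of "k + 1"] by (simp add: algebra_simps)
qed

section \<open>Solving the recurrence and expressing the solution by \<open>Delta\<close>\<close>

lemma Suc_times_binomial_int:
  "(int k + 1) * int (N choose (k + 1)) = (int N - int k) * int (N choose k)"
proof (cases "k \<le> N")
  case True
  have "(k + 1) * (N choose (k + 1)) = (N - k) * (N choose k)"
    using binomial_absorption[of k N] binomial_absorb_comp[of N k] by simp
  then have "int ((k + 1) * (N choose (k + 1))) = int ((N - k) * (N choose k))"
    by simp
  then show ?thesis using True by (simp add: of_nat_diff algebra_simps)
qed (simp add: binomial_eq_0)

text \<open>The coefficients of \<open>(1 + x) (1 - x\<^sup>2) ^ m\<close>, which span the solutions
  of the homogeneous recurrence.\<close>

definition krawt :: "nat \<Rightarrow> nat \<Rightarrow> int" where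
  "krawt m i = (- 1) ^ (i div 2) * int (m choose (i div 2))"

lemma krawt_0_1 [simp]: "krawt m 0 = 1" "krawt m (Suc 0) = 1"
  by (simp_all add: krawt_def)

text \<open>The values at \<open>2 * l\<close> and \<open>2 * l + 1\<close> coincide, so for either
  parity of \<open>k\<close> the equation collapses to the absorption identity for
  \<open>m choose l\<close>. In terms of the generating function \<open>G\<close>, it says
  \<open>(1 - x^2) G' = (1 - (2 m + 1) x) G\<close>.\<close>

lemma krawt_recurrence:
  "(int k + 2) * krawt m (k + 2) + (2 * int m + 1 - int k) * krawt m k = krawt m (k + 1)"
proof -
  have "(2 * L + 2) * (s * B) = (2 * M - 2 * L) * (s * A)"
    if "(L + 1) * B = (M - L) * A" for L M A B s :: int
    using that by algebra
  from this[OF Suc_times_binomial_int]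
  have key: "(2 * int l + 2) * ((- 1) ^ l * int (m choose (l + 1))) =
      (2 * int m - 2 * int l) * ((- 1) ^ l * int (m choose l))" for l
    by blast
  show ?thesis
  proof (cases "even k")
    case True
    then obtain l where "k = 2 * l" by blast
    then show ?thesis using key[of l] by (simp add: krawt_def algebra_simps)
  next
    case False
    then obtain l where k: "k = 2 * l + 1" using oddE by blast
    have d: "(2 * l + 1) div 2 = l" "(2 * l + 1 + 2) div 2 = l + 1" "(2 * l + 1 + 1) div 2 = l + 1"
      by simp_all
    show ?thesis
      using key[of l] unfolding krawt_def k d by (simp add: algebra_simps)
  qed
qed

text \<open>\<open>(N choose i) / n\<close> is a particular solution and \<open>krawt m\<close>
  solves the homogeneous equation. The value at 0 fixes the coefficient \<open>n * F 0 - 1\<close>,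
  and \<open>F1\<close> is consistent with it. Multiplication by \<open>n\<close> keeps everything
  integral.\<close>

lemma recurrence_solution:
  fixes F :: "nat \<Rightarrow> int"
  assumes F1: "F 1 = 1 + F 0"
    and F: "\<And>k. (int k + 2) * F (k + 2) + (int N - k) * F k = int (N choose (k + 1)) + F (k + 1)"
    and N: "N = n + 1" "n = 2 * m"
  shows "int n * F i = int (N choose i) + (int n * F 0 - 1) * krawt m i"
proof (induction i rule: induct_nat_012)
  case (ge2 k)
  let ?c = "int n * F 0 - 1"
  have b1: "(int k + 1) * int (N choose (k + 1)) = (int N - int k) * int (N choose k)"
    by (rule Suc_times_binomial_int)
  have b2: "(int k + 2) * int (N choose (k + 2)) = (int N - int k - 1) * int (N choose (k + 1))"
    using Suc_times_binomial_int[of "k + 1" N] by (simp add: algebra_simps)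
  have "(int k + 2) * (int n * F (k + 2)) =
      int n * int (N choose (k + 1)) + int n * F (k + 1) - (int N - k) * (int n * F k)"
    using arg_cong[OF F[of k], of "\<lambda>x. int n * x"] by (simp add: algebra_simps)
  also have "\<dots> = int n * int (N choose (k + 1)) + (int (N choose (k + 1)) + ?c * krawt m (k + 1))
      - (int N - k) * (int (N choose k) + ?c * krawt m k)"
    using ge2 by simp
  also have "\<dots> = int N * int (N choose (k + 1)) - (int N - k) * int (N choose k)
      + ?c * (krawt m (k + 1) - (int N - k) * krawt m k)"
    by (simp add: N algebra_simps)
  also have "int N * int (N choose (k + 1)) - (int N - k) * int (N choose k) =
      (int k + 2) * int (N choose (k + 2))"
    unfolding b2 b1[symmetric] by (simp add: algebra_simps)
  also have "krawt m (k + 1) - (int N - k) * krawt m k = (int k + 2) * krawt m (k + 2)"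
    using krawt_recurrence[of k m] by (simp add: N algebra_simps)
  finally have "(int k + 2) * (int n * F (k + 2)) =
      (int k + 2) * (int (N choose (k + 2)) + ?c * krawt m (k + 2))"
    by (simp add: algebra_simps)
  then show ?case by simp
qed (use F1 N in \<open>simp_all add: algebra_simps\<close>)

text \<open>For even \<open>i\<close> the two signs agree, and Pascal's rule merges the two
  binomials of \<open>\<nu>\<close> into one of \<open>\<nu> + 1\<close>.\<close>

lemma Delta_sum_even:
  assumes "even i" "i > 0"
  shows "Delta \<nu> (i - 1) + Delta \<nu> i = krawt (\<nu> + 1) i"
proof -
  from assms obtain l where i: "i = 2 * Suc l"
    by (metis dvdE mult_0_right not0_implies_Suc not_gr_zero)
  have d: "(i - Suc 0) div 2 = l" "i div 2 = l + 1" by (simp_all add: i)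
  show ?thesis
  proof (cases "even l")
    case True
    then obtain q where "l = 2 * q" by blast
    then have "i mod 4 = 2" "(i - 1) mod 4 = 1" by (simp_all add: i; presburger)+
    with True show ?thesis by (simp add: Delta_def krawt_def d)
  next
    case False
    then obtain q where "l = 2 * q + 1" using oddE by blast
    then have "i mod 4 = 0" "(i - 1) mod 4 = 3" by (simp_all add: i; presburger)+
    with False show ?thesis by (simp add: Delta_def krawt_def d)
  qed
qed

text \<open>For odd \<open>i\<close> the indices \<open>i\<close> and \<open>i - 1\<close> have the
  same half, so the even case at \<open>i - 1\<close> applies.\<close>

lemma Delta_sum_odd:
  assumes "odd i" "i > 1"
  shows "Delta \<nu> (i - 1) + Delta \<nu> (i - 2) = krawt (\<nu> + 1) i"
proof -
  have "krawt (\<nu> + 1) i = krawt (\<nu> + 1) (i - 1)"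
    using assms by (auto simp: krawt_def elim!: oddE)
  moreover have "Delta \<nu> (i - 1 - 1) + Delta \<nu> (i - 1) = krawt (\<nu> + 1) (i - 1)"
    using assms by (intro Delta_sum_even) auto
  ultimately show ?thesis
    by (simp add: add.commute numeral_2_eq_2)
qed

section \<open>Extended codes as coverings of one parity class\<close>

lemma hamming_dist_le_1:
  assumes "length c = length x" "hamming_dist x c \<le> 1"
  shows "c = x \<or> (\<exists>i<length x. c = flip i x)"
proof (cases "hamming_dist x c = 0")
  case True
  then have "c = x"
    using assms(1) by (auto simp: hamming_dist_def intro!: nth_equalityI)
  then show ?thesis ..
next
  case False
  then have "hamming_dist x c = 1" using assms(2) by simp
  then obtain i where i: "{i. i < length x \<and> x ! i \<noteq> c ! i} = {i}"
    unfolding hamming_dist_def using card_1_singletonE by blast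
  then have "i < length x" "x ! i \<noteq> c ! i" by auto
  moreover have "c = flip i x"
  proof (rule nth_equalityI)
    fix j assume "j < length c"
    then have "x ! j \<noteq> c ! j \<longleftrightarrow> j = i" "j < length x" using i assms(1) by auto
    then show "c ! j = flip i x ! j"
      by (cases "x ! j"; cases "c ! j") (auto simp: flip_def)
  qed (use assms in simp)
  ultimately show ?thesis by blast
qed

lemma flip_append:
  "flip i (x @ y) = (if i < length x then flip i x @ y else x @ flip (i - length x) y)"
  by (simp add: flip_def list_update_append nth_append)

text \<open>This supplies the hypotheses of \<open>covering_completion\<close>, with
  \<open>\<epsilon>\<close> the bit added to the parity. To cover a word of the wrong parity, cover
  its first \<open>n\<close> bits: flip the last bit if they already equal the covering codeword,
  and otherwise the bit where the two differ.\<close>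

lemma extended_code:
  assumes C: "np1cc r C" and D: "D = {c @ [\<epsilon> + parity_bit c] | c. c \<in> C}"
    and n: "n = 2 ^ r" and "r > 0"
  shows "D \<subseteq> words (n + 1)"
    and "d \<in> D \<Longrightarrow> odd (weight d) \<longleftrightarrow> \<epsilon> = 1"
    and "card D * n = 2 ^ n"
    and "w \<in> words (n + 1) \<Longrightarrow> odd (weight w) \<noteq> (\<epsilon> = 1) \<Longrightarrow> \<exists>i<n + 1. flip i w \<in> D"
proof -
  have C': "C \<subseteq> words n" "card C = 2 ^ (n - r)"
      "\<And>x. x \<in> words n \<Longrightarrow> \<exists>c\<in>C. hamming_dist x c \<le> 1"
    using C by (auto simp: np1cc_def n)
  show "D \<subseteq> words (n + 1)"
    using C'(1) by (auto simp: D words_def)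
  show "odd (weight d) \<longleftrightarrow> \<epsilon> = 1" if "d \<in> D"
    using that by (cases \<epsilon>) (auto simp: D parity_bit_def sum_list_eq_odd_weight)
  have "D = (\<lambda>c. c @ [\<epsilon> + parity_bit c]) ` C" by (auto simp: D)
  then have "card D = card C" by (simp add: card_image inj_on_def)
  moreover have "(2::nat) ^ (n - r) * 2 ^ r = 2 ^ n"
    \<comment> \<open>\<open>r < 2 ^ r\<close> makes \<open>n - r\<close> a genuine
      difference.\<close>
    using less_exp[of r] by (simp add: n flip: power_add)
  ultimately show "card D * n = 2 ^ n"
    by (simp add: C'(2) n)
  show "\<exists>i<n + 1. flip i w \<in> D" if w: "w \<in> words (n + 1)" "odd (weight w) \<noteq> (\<epsilon> = 1)"
  proof -
    obtain x b where xb: "w = x @ [b]" "length x = n"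
      using w(1) by (cases w rule: rev_cases) (auto simp: words_def)
    obtain c where c: "c \<in> C" "hamming_dist x c \<le> 1"
      using C'(3)[of x] xb(2) by (auto simp: words_def)
    \<comment> \<open>The wrong parity means that the last bit is the complement of the extension
      bit of \<open>x\<close>.\<close>
    have b: "b = 1 + (\<epsilon> + parity_bit x)"
      using w(2) by (cases b; cases \<epsilon>) (auto simp: xb(1) parity_bit_def sum_list_eq_odd_weight)
    have "length c = length x" using c(1) C'(1) xb(2) by (auto simp: words_def)
    from hamming_dist_le_1[OF this c(2)] show ?thesis
    proof (elim disjE exE conjE)
      assume "c = x"
      moreover have "flip n w = x @ [\<epsilon> + parity_bit x]"
        by (cases "\<epsilon> + parity_bit x")
          (use b xb(2) in \<open>auto simp: xb(1) flip_append flip_def simp del: add_bit_eq_xor\<close>)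
      ultimately show ?thesis using c(1) by (auto simp: D intro!: exI[of _ n])
    next
      fix i assume i: "i < length x" "c = flip i x"
      \<comment> \<open>The flip changes the parity as well, so the extension bit of
        \<open>c\<close> is exactly the last bit \<open>b\<close> of \<open>w\<close>.\<close>
      have "parity_bit c = 1 + parity_bit x"
        using even_weight_flip[OF i(1)] by (simp add: i(2) parity_bit_def sum_list_eq_odd_weight)
      then have "flip i w = c @ [\<epsilon> + parity_bit c]"
        using i b by (simp add: xb flip_append add.left_commute)
      then show ?thesis using c(1) i(1) xb(2) by (auto simp: D intro!: exI[of _ i])
    qed
  qed
qed

text \<open>Writing the first form with \<open>0 + parity_bit c\<close> lets one bit
  \<open>\<epsilon>\<close> stand for both kinds of extension.\<close>

lemma enp1ccE:
  assumes "enp1cc r C"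
  obtains D \<epsilon> where "np1cc r D" "C = {c @ [\<epsilon> + parity_bit c] | c. c \<in> D}"
proof -
  obtain D where D: "np1cc r D" and
    C: "C = {c @ [0 + parity_bit c] | c. c \<in> D} \<or> C = {c @ [1 + parity_bit c] | c. c \<in> D}"
    using assms unfolding enp1cc_def add_0 by blast
  from C show thesis
    by (elim disjE) (rule that[OF D], assumption)+
qed

text \<open>\<open>F\<close> is the weight distribution of the completed code and \<open>b\<close>
  records the parity of the codewords. Only \<open>F 0\<close> is left to be determined in each
  case.\<close>

lemma enp1cc_weight_distribution:
  assumes "r > 0" and n: "n = 2 ^ r" and m: "m = 2 ^ (r - 1)" and C: "enp1cc r C"
  obtains b F where
    "\<And>c. c \<in> C \<Longrightarrow> odd (weight c) = b"
    "\<And>i. odd i = b \<Longrightarrow> int (weight_count C i) = F i"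
    "F 1 = 1 + F 0"
    "\<And>i. int n * F i = int ((n + 1) choose i) + (int n * F 0 - 1) * krawt m i"
proof -
  obtain D \<epsilon> where D: "np1cc r D" "C = {c @ [\<epsilon> + parity_bit c] | c. c \<in> D}"
    using C by (rule enp1ccE)
  note ext = extended_code[OF D n \<open>r > 0\<close>]
  have n2: "n = 2 * m" using \<open>r > 0\<close> by (simp add: n m flip: power_Suc)
  obtain Z where Z: "Z \<subseteq> words (n + 1)" "\<And>z. z \<in> Z \<Longrightarrow> odd (weight z) \<noteq> (\<epsilon> = 1)"
    "\<And>w. w \<in> words (n + 1) \<Longrightarrow>
       nbr_sum (\<lambda>v. of_bool (v \<in> C \<union> Z)) w = 1 + of_bool (w \<in> C \<union> Z)"
    by (rule covering_completion[of C "n + 1" "\<epsilon> = 1"]) (use ext n2 in auto)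
  define F where "F = (\<lambda>i. int (weight_count (C \<union> Z) i))"
  have S: "C \<union> Z \<subseteq> words (n + 1)" using ext(1) Z(1) by auto
  note rec = weight_count_recurrence[OF S Z(3)]
  show thesis
  proof (rule that[of "\<epsilon> = 1" F])
    show "F 1 = 1 + F 0" using rec(1) by (simp add: F_def)
    then show "int n * F i = int ((n + 1) choose i) + (int n * F 0 - 1) * krawt m i" for i
      by (rule recurrence_solution) (use rec(2) n2 in \<open>auto simp: F_def\<close>)
    show "int (weight_count C i) = F i" if "odd i = (\<epsilon> = 1)" for i
    proof -
      \<comment> \<open>At weights of the parity of \<open>C\<close> the completing set
        \<open>Z\<close> contributes nothing.\<close>
      have "{c \<in> C \<union> Z. weight c = i} = {c \<in> C. weight c = i}"
        using Z(2) that by auto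
      then show ?thesis by (simp add: F_def weight_count_def)
    qed
  qed (use ext(2) in auto)
qed

section \<open>The four weight distributions\<close>

theorem theorem6:
  fixes r n \<nu> :: nat and C :: "word set"
  assumes "r \<ge> 2" and "n = 2 ^ r" and "\<nu> = 2 ^ (r - 1) - 1"
    and "enp1cc r C"
  shows
    "(zeroed (n + 1) C \<longrightarrow>
        (\<forall>i. odd i \<longrightarrow> weight_count C i = 0) \<and>
        weight_count C 0 = 1 \<and>
        (\<forall>i. even i \<and> i > 0 \<longrightarrow>
           real (weight_count C i) =
             (real ((n + 1) choose i)
               + (real n - 1) * (of_int (Delta \<nu> (i - 1)) + of_int (Delta \<nu> i))) / real n)) \<and>
     (\<not> zeroed (n + 1) C \<and> card {c \<in> C. weight c = 1} = 1 \<longrightarrow>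
        (\<forall>i. even i \<longrightarrow> weight_count C i = 0) \<and>
        weight_count C 1 = 1 \<and>
        (\<forall>i. odd i \<and> i > 1 \<longrightarrow>
           real (weight_count C i) =
             (real ((n + 1) choose i)
               - (of_int (Delta \<nu> (i - 1)) + of_int (Delta \<nu> (i - 2)))) / real n)) \<and>
     (\<not> zeroed (n + 1) C \<and> card {c \<in> C. weight c = 1} = 2 \<longrightarrow>
        (\<forall>i. even i \<longrightarrow> weight_count C i = 0) \<and>
        weight_count C 1 = 2 \<and>
        (\<forall>i. odd i \<and> i > 1 \<longrightarrow>
           real (weight_count C i) =
             (real ((n + 1) choose i)
               + (real n - 1) * (of_int (Delta \<nu> (i - 1)) + of_int (Delta \<nu> (i - 2)))) / real n)) \<and>
     (\<not> zeroed (n + 1) C \<and> (\<forall>c \<in> C. even (weight c)) \<longrightarrow>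
        (\<forall>i. odd i \<longrightarrow> weight_count C i = 0) \<and>
        weight_count C 0 = 0 \<and>
        (\<forall>i. even i \<and> i > 0 \<longrightarrow>
           real (weight_count C i) =
             (real ((n + 1) choose i)
               - (of_int (Delta \<nu> i) + of_int (Delta \<nu> (i - 1)))) / real n))"
proof -
  have r: "r > 0" and npos: "n > 0" and m: "\<nu> + 1 = 2 ^ (r - 1)"
    using assms(1-3) by simp_all
  obtain b F where parity: "\<And>c. c \<in> C \<Longrightarrow> odd (weight c) = b"
    and wF: "\<And>i. odd i = b \<Longrightarrow> int (weight_count C i) = F i"
    and F1: "F 1 = 1 + F 0"
    and F: "\<And>i. int n * F i =
      int ((n + 1) choose i) + (int n * F 0 - 1) * krawt (\<nu> + 1) i"
    using enp1cc_weight_distribution[OF r assms(2) m assms(4)] by metis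
  have zero: "weight_count C i = 0" if "odd i \<noteq> b" for i
  proof -
    have "{c \<in> C. weight c = i} = {}" using parity that by auto
    then show ?thesis by (simp only: weight_count_def card.empty)
  qed
  have len: "length c = n + 1" if "c \<in> C" for c
    using assms(4) that by (auto simp: enp1cc_def np1cc_def words_def assms(2))
  have wt0: "{c \<in> C. weight c = 0} = (if zeroed (n + 1) C then {replicate (n + 1) 0} else {})"
    using len by (auto simp: zeroed_def weight_eq_0_iff simp del: replicate_Suc)
  have count0: "weight_count C 0 = of_bool (zeroed (n + 1) C)"
    by (simp add: weight_count_def wt0)
  \<comment> \<open>The free \<open>d\<close> accepts whichever \<open>Delta\<close> expression
    equals the \<open>krawt\<close> term, for either parity of \<open>i\<close>.\<close>
  have F_real: "real (weight_count C i) = (real ((n + 1) choose i) + (real n * F 0 - 1) * d) / real n"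
    if "odd i = b" "d = of_int (krawt (\<nu> + 1) i)" for i d
  proof -
    have "real_of_int (int n * F i) =
        of_int (int ((n + 1) choose i) + (int n * F 0 - 1) * krawt (\<nu> + 1) i)"
      by (rule arg_cong[OF F])
    then have "real n * real_of_int (F i) = real ((n + 1) choose i) + (real n * F 0 - 1) * d"
      using that(2) by simp
    moreover have "real (weight_count C i) = real_of_int (F i)"
      using wF[OF that(1)] by (metis of_int_of_nat_eq)
    ultimately show ?thesis using npos by (simp add: field_simps)
  qed
  have Dev: "of_int (Delta \<nu> (i - 1)) + of_int (Delta \<nu> i) = real_of_int (krawt (\<nu> + 1) i)"
    if "even i \<and> i > 0" for i
    using Delta_sum_even[of i \<nu>] that by (metis of_int_add)
  have Dod: "of_int (Delta \<nu> (i - 1)) + of_int (Delta \<nu> (i - 2)) = real_of_int (krawt (\<nu> + 1) i)"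
    if "odd i \<and> i > 1" for i
    using Delta_sum_odd[of i \<nu>] that by (metis of_int_add)
  \<comment> \<open>A word of weight one forces odd parity. Then \<open>F 1 = j\<close> yields
    \<open>F 0 = j - 1\<close>, so the coefficient \<open>n * F 0 - 1\<close> is \<open>- 1\<close>
    for \<open>j = 1\<close> and \<open>n - 1\<close> for \<open>j = 2\<close>.\<close>
  have case_odd: "b \<and> weight_count C 1 = j \<and> F 0 = int j - 1"
    if "card {c \<in> C. weight c = 1} = j" "j > 0" for j
  proof -
    have "{c \<in> C. weight c = 1} \<noteq> {}" using that by (metis card.empty less_irrefl)
    then have b using parity by force
    moreover have "weight_count C 1 = j" using that by (simp add: weight_count_def)
    ultimately show ?thesis using wF[of 1] F1 by simp
  qed
  show ?thesis
  proof (intro conjI impI)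
    assume z: "zeroed (n + 1) C"
    \<comment> \<open>The all-zero codeword forces even parity and \<open>F 0 = 1\<close>, which
      gives the coefficient \<open>n - 1\<close>.\<close>
    have "weight (replicate (n + 1) 0) = 0"
      unfolding weight_eq_0_iff by (simp only: length_replicate)
    then have b: "\<not> b"
      using parity[of "replicate (n + 1) 0"] z by (simp only: zeroed_def) simp
    have F0: "F 0 = 1" using wF[of 0] b count0 z by simp
    show "\<forall>i. odd i \<longrightarrow> weight_count C i = 0" using zero b by auto
    show "weight_count C 0 = 1" using count0 z by simp
    show "\<forall>i. even i \<and> i > 0 \<longrightarrow> real (weight_count C i) =
        (real ((n + 1) choose i) + (real n - 1) * (of_int (Delta \<nu> (i - 1)) + of_int (Delta \<nu> i))) / real n"
    proof (intro allI impI)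
      fix i :: nat assume i: "even i \<and> i > 0"
      show "real (weight_count C i) =
        (real ((n + 1) choose i) + (real n - 1) * (of_int (Delta \<nu> (i - 1)) + of_int (Delta \<nu> i))) / real n"
        using F_real[OF _ Dev[OF i]] b F0 i by simp
    qed
  next
    assume a: "\<not> zeroed (n + 1) C \<and> card {c \<in> C. weight c = 1} = 1"
    then have b: b "weight_count C 1 = 1" "F 0 = 0" using case_odd[of 1] by auto
    show "\<forall>i. even i \<longrightarrow> weight_count C i = 0" using zero b by auto
    show "weight_count C 1 = 1" by fact
    show "\<forall>i. odd i \<and> i > 1 \<longrightarrow> real (weight_count C i) =
        (real ((n + 1) choose i) - (of_int (Delta \<nu> (i - 1)) + of_int (Delta \<nu> (i - 2)))) / real n"
    proof (intro allI impI)
      fix i :: nat assume i: "odd i \<and> i > 1"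
      show "real (weight_count C i) =
        (real ((n + 1) choose i) - (of_int (Delta \<nu> (i - 1)) + of_int (Delta \<nu> (i - 2)))) / real n"
        using F_real[OF _ Dod[OF i]] b i by simp
    qed
  next
    assume a: "\<not> zeroed (n + 1) C \<and> card {c \<in> C. weight c = 1} = 2"
    then have b: b "weight_count C 1 = 2" "F 0 = 1" using case_odd[of 2] by auto
    show "\<forall>i. even i \<longrightarrow> weight_count C i = 0" using zero b by auto
    show "weight_count C 1 = 2" by fact
    show "\<forall>i. odd i \<and> i > 1 \<longrightarrow> real (weight_count C i) =
        (real ((n + 1) choose i) + (real n - 1) * (of_int (Delta \<nu> (i - 1)) + of_int (Delta \<nu> (i - 2)))) / real n"
    proof (intro allI impI)
      fix i :: nat assume i: "odd i \<and> i > 1"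
      show "real (weight_count C i) =
        (real ((n + 1) choose i) + (real n - 1) * (of_int (Delta \<nu> (i - 1)) + of_int (Delta \<nu> (i - 2)))) / real n"
        using F_real[OF _ Dod[OF i]] b i by simp
    qed
  next
    assume a: "\<not> zeroed (n + 1) C \<and> (\<forall>c\<in>C. even (weight c))"
    \<comment> \<open>\<open>b\<close> is tied to actual codewords, so even weights refute
      \<open>b\<close> once some codeword exists.\<close>
    have "C \<noteq> {}"
    proof -
      obtain D \<epsilon> where D: "np1cc r D" "C = {c @ [\<epsilon> + parity_bit c] | c. c \<in> D}"
        using assms(4) by (rule enp1ccE)
      have "card D \<noteq> 0" using D(1) by (simp add: np1cc_def)
      then show ?thesis using D(2) by (auto simp: card_eq_0_iff)
    qed
    then have b: "\<not> b" using a parity by auto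
    \<comment> \<open>Under even parity \<open>F 0\<close> counts the all-zero codeword, which is
      absent; the coefficient becomes \<open>- 1\<close>.\<close>
    have F0: "F 0 = 0" using wF[of 0] b count0 a by simp
    show "\<forall>i. odd i \<longrightarrow> weight_count C i = 0" using zero b by auto
    show "weight_count C 0 = 0" using count0 a by simp
    show "\<forall>i. even i \<and> i > 0 \<longrightarrow> real (weight_count C i) =
        (real ((n + 1) choose i) - (of_int (Delta \<nu> i) + of_int (Delta \<nu> (i - 1)))) / real n"
    proof (intro allI impI)
      fix i :: nat assume i: "even i \<and> i > 0"
      show "real (weight_count C i) =
        (real ((n + 1) choose i) - (of_int (Delta \<nu> i) + of_int (Delta \<nu> (i - 1)))) / real n"
        using F_real[OF _ trans[OF add.commute Dev[OF i]]] b F0 i by simp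
    qed
  qed
qed

end
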